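(* Let $\lambda>0$, $\gamma>0$, and let $$A=\begin{pmatrix}-\lambda-\frac{\gamma}{2} & \frac{\gamma}{2}\\ \frac{\gamma}{2} & -\lambda-\frac{\gamma}{2}\end{pmatrix},$$ which has the distinct real eigenvalues $-\lambda$ and $-(\lambda+\gamma)$. Let $\Lambda_{\mathrm s}\subset\mathbb{R}^2$ be the slow eigenspace of $A$, i.e. the eigenspace corresponding to $-\lambda$. Fix $t_{\mathrm f}\in\mathbb{R}$, an index $j\in\{1,2\}$ and a value $x_j^{t_{\mathrm f}}\in\mathbb{R}$. For each $t_0<t_{\mathrm f}$ let $x^*=x^*_{t_0}$ be the optimal solution of the variational problem $$\min_{x(\cdot)}\int_{t_0}^{t_{\mathrm f}}\|A A x(t)\|_2^2\,\mathrm{d}t\quad\text{subject to}\quad \dot x(t)=A x(t)\ \text{ on } [t_0,t_{\mathrm f}],\qquad x_j(t_{\mathrm f})=x_j^{t_{\mathrm f}}.$$ Then $$\lim_{t_0\to-\infty} d\bigl(x^*(t_{\mathrm f}),\Lambda_{\mathrm s}\bigr)=\lim_{t_0\to-\infty}\ \inf_{b\in\Lambda_{\mathrm s}}\|x^*(t_{\mathrm f})-b\|_2=0 .$$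
   Context: $\|\cdot\|_2$ is the Euclidean norm on $\mathbb{R}^2$. The minimization is over all solutions $x=(x_1,x_2):[t_0,t_{\mathrm f}]\to\mathbb{R}^2$ of the ODE satisfying the prescribed final value of the single component $x_j$ (the "progress variable"); the other component at time $t_{\mathrm f}$ is free. The values $t_{\mathrm f}$, $j$, $x_j^{t_{\mathrm f}}$, $\lambda$, $\gamma$ are held fixed as $t_0\to-\infty$. The integrand is $\|J_f(x(t))f(x(t))\|_2^2$ for $f(x)=Ax$, where $J_f$ is the Jacobian of $f$. *)

theory Defs
  imports "HOL-Analysis.Analysis"
begin

definition sysmat :: "real \<Rightarrow> real \<Rightarrow> real^2^2" where
  "sysmat lam gam = vector
     [vector [- lam - gam / 2, gam / 2],
      vector [gam / 2, - lam - gam / 2]]"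

definition eigenspace :: "real^'n^'n \<Rightarrow> real \<Rightarrow> (real^'n) set" where
  "eigenspace A \<mu> = {v. A *v v = \<mu> *\<^sub>R v}"

text \<open>Only the values of a trajectory on \<open>[t0, tf]\<close> matter; the derivatives at the
  end points are one-sided.\<close>

definition feasible ::
  "real^'n^'n \<Rightarrow> real \<Rightarrow> real \<Rightarrow> 'n \<Rightarrow> real \<Rightarrow> (real \<Rightarrow> real^'n) \<Rightarrow> bool" where
  "feasible A t0 tf j c x \<longleftrightarrow>
     (\<forall>t\<in>{t0..tf}. (x has_vector_derivative A *v x t) (at t within {t0..tf})) \<and>
     x tf $ j = c"

definition objective :: "real^'n^'n \<Rightarrow> real \<Rightarrow> real \<Rightarrow> (real \<Rightarrow> real^'n) \<Rightarrow> real" where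
  "objective A t0 tf x = integral {t0..tf} (\<lambda>t. (norm (A *v (A *v x t)))\<^sup>2)"

definition optimal ::
  "real^'n^'n \<Rightarrow> real \<Rightarrow> real \<Rightarrow> 'n \<Rightarrow> real \<Rightarrow> (real \<Rightarrow> real^'n) \<Rightarrow> bool" where
  "optimal A t0 tf j c x \<longleftrightarrow>
     feasible A t0 tf j c x \<and>
     (\<forall>y. feasible A t0 tf j c y \<longrightarrow> objective A t0 tf x \<le> objective A t0 tf y)"

end

theory Submission
  imports Defs "HOL-Real_Asymp.Real_Asymp"
begin

text \<open>In the coordinates \<open>x\<^sub>1 + x\<^sub>2\<close> and \<open>x\<^sub>1 - x\<^sub>2\<close> the system decouples into two scalar equations
  with rates \<open>-\<lambda>\<close> and \<open>-(\<lambda> + \<gamma>)\<close>, and the objective is a weighted sum of squares of the final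
  values \<open>U\<close>, \<open>V\<close> of these coordinates. Comparing an optimal trajectory with the slow feasible one
  (\<open>V = 0\<close>) bounds \<open>V\<^sup>2\<close> by a constant times the ratio of the two weights, which decays like
  \<open>exp (-2 \<gamma> (t\<^sub>f - t\<^sub>0))\<close>. No explicit minimiser is needed.\<close>

text \<open>The integrating factor \<open>exp (- k * (s - b))\<close> turns \<open>u\<close> into a
  function with zero derivative. It is anchored at the right end point because the constraint of the
  problem sits at the final time.\<close>

lemma scalar_linear_ode_unique:
  fixes u :: "real \<Rightarrow> real"
  assumes ode: "\<And>t. t \<in> {a..b} \<Longrightarrow> (u has_real_derivative k * u t) (at t within {a..b})"
    and t: "t \<in> {a..b}"
  shows "u t = exp (k * (t - b)) * u b"
proof -
  have "\<exists>c. \<forall>s\<in>{a..b}. exp (- k * (s - b)) * u s = c"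
  proof (rule has_field_derivative_zero_constant)
    fix s assume s: "s \<in> {a..b}"
    show "((\<lambda>s. exp (- k * (s - b)) * u s) has_real_derivative 0) (at s within {a..b})"
      by (rule derivative_eq_intros ode[OF s] refl | simp add: algebra_simps)+
  qed simp
  then have "exp (- k * (t - b)) * u t = exp (- k * (b - b)) * u b"
    using t by (metis atLeastAtMost_iff order_refl order_trans)
  then have "exp (k * (t - b)) * (exp (- k * (t - b)) * u t) = exp (k * (t - b)) * u b"
    by simp
  then show ?thesis
    by (simp add: mult.assoc[symmetric] flip: exp_add)
qed

lemma has_integral_exp_square:
  fixes a b k :: real
  assumes "a \<le> b" "k \<noteq> 0"
  shows "((\<lambda>t. (exp (- k * (t - b)))\<^sup>2) has_integral (exp (2 * k * (b - a)) - 1) / (2 * k)) {a..b}"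
proof -
  have "((\<lambda>t. (exp (- k * (t - b)))\<^sup>2) has_integral
      - exp (- 2 * k * (b - b)) / (2 * k) - - exp (- 2 * k * (a - b)) / (2 * k)) {a..b}"
  proof (rule fundamental_theorem_of_calculus[OF \<open>a \<le> b\<close>])
    fix t assume "t \<in> {a..b}"
    have "((\<lambda>t. - exp (- 2 * k * (t - b)) / (2 * k)) has_real_derivative (exp (- k * (t - b)))\<^sup>2)
        (at t within {a..b})"
      using \<open>k \<noteq> 0\<close> by (auto intro!: derivative_eq_intros simp flip: exp_double)
    then show "((\<lambda>t. - exp (- 2 * k * (t - b)) / (2 * k)) has_vector_derivative
        (exp (- k * (t - b)))\<^sup>2) (at t within {a..b})"
      by (simp add: has_real_derivative_iff_has_vector_derivative)
  qed
  moreover have "- exp (- 2 * k * (b - b)) / (2 * k) - - exp (- 2 * k * (a - b)) / (2 * k)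
      = (exp (2 * k * (b - a)) - 1) / (2 * k)"
    by (simp add: diff_divide_distrib algebra_simps)
  ultimately show ?thesis by simp
qed

lemma sysmat_nth:
  "(sysmat lam gam *v x) $ 1 = (- lam - gam / 2) * x $ 1 + gam / 2 * x $ 2"
  "(sysmat lam gam *v x) $ 2 = gam / 2 * x $ 1 + (- lam - gam / 2) * x $ 2"
  by (simp_all add: sysmat_def matrix_vector_mult_def sum_2)

text \<open>The rows (1, 1) and (1, -1) are left eigenvectors of the matrix; this and the next lemma
  are what decouples the system.\<close>

lemma sysmat_sum:
  "(sysmat lam gam *v x) $ 1 + (sysmat lam gam *v x) $ 2 = - lam * (x $ 1 + x $ 2)"
  by (simp add: sysmat_nth algebra_simps)

lemma sysmat_diff:
  "(sysmat lam gam *v x) $ 1 - (sysmat lam gam *v x) $ 2 = - (lam + gam) * (x $ 1 - x $ 2)"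
  by (simp add: sysmat_nth algebra_simps)

lemma norm_square_sum_diff:
  fixes x :: "real^2"
  shows "(norm x)\<^sup>2 = ((x $ 1 + x $ 2)\<^sup>2 + (x $ 1 - x $ 2)\<^sup>2) / 2"
  unfolding power2_norm_eq_inner by (simp add: inner_vec_def sum_2 power2_eq_square algebra_simps)

text \<open>Each application of the matrix scales the sum and the difference by their eigenvalues,
  so two applications and a square give fourth powers. There is no mixed term since the two
  eigendirections are orthogonal.\<close>

lemma norm_sysmat_sysmat:
  "(norm (sysmat lam gam *v (sysmat lam gam *v x)))\<^sup>2
    = (lam ^ 4 * (x $ 1 + x $ 2)\<^sup>2 + (lam + gam) ^ 4 * (x $ 1 - x $ 2)\<^sup>2) / 2"
proof -
  have "(k * (k * z))\<^sup>2 = k ^ 4 * z\<^sup>2" for k z :: real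
    by (simp add: power_mult_distrib mult.assoc[symmetric] flip: power_add)
  from this[of lam] this[of "lam + gam"] show ?thesis
    by (simp only: norm_square_sum_diff sysmat_sum sysmat_diff mult_minus_left mult_minus_right
        minus_minus)
qed

lemma feasible_sum_diff:
  assumes "feasible (sysmat lam gam) t0 tf j c x" "t \<in> {t0..tf}"
  shows "x t $ 1 + x t $ 2 = exp (- lam * (t - tf)) * (x tf $ 1 + x tf $ 2)"
    and "x t $ 1 - x t $ 2 = exp (- (lam + gam) * (t - tf)) * (x tf $ 1 - x tf $ 2)"
proof -
  have comp: "((\<lambda>s. x s $ i) has_real_derivative (sysmat lam gam *v x s) $ i) (at s within {t0..tf})"
    if "s \<in> {t0..tf}" for s i
    using assms(1) that bounded_linear.has_vector_derivative[OF bounded_linear_vec_nth]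
    unfolding feasible_def has_real_derivative_iff_has_vector_derivative by blast
  show "x t $ 1 + x t $ 2 = exp (- lam * (t - tf)) * (x tf $ 1 + x tf $ 2)"
    by (rule scalar_linear_ode_unique[OF _ assms(2)])
      (use DERIV_add[OF comp comp, of _ 1 2] in \<open>simp only: sysmat_sum\<close>)
  show "x t $ 1 - x t $ 2 = exp (- (lam + gam) * (t - tf)) * (x tf $ 1 - x tf $ 2)"
    by (rule scalar_linear_ode_unique[OF _ assms(2)])
      (use DERIV_diff[OF comp comp, of _ 1 2] in \<open>simp only: sysmat_diff\<close>)
qed

lemma objective_feasible:
  assumes "feasible (sysmat lam gam) t0 tf j c x" "t0 \<le> tf" "lam > 0" "gam > 0"
  shows "objective (sysmat lam gam) t0 tf x =
    (lam ^ 4 * (x tf $ 1 + x tf $ 2)\<^sup>2 * ((exp (2 * lam * (tf - t0)) - 1) / (2 * lam)) +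
     (lam + gam) ^ 4 * (x tf $ 1 - x tf $ 2)\<^sup>2 *
       ((exp (2 * (lam + gam) * (tf - t0)) - 1) / (2 * (lam + gam)))) / 2"
    (is "_ = (?P * ?I + ?Q * ?J) / 2")
proof -
  have "((\<lambda>t. (?P * (exp (- lam * (t - tf)))\<^sup>2 + ?Q * (exp (- (lam + gam) * (t - tf)))\<^sup>2) / 2)
      has_integral (?P * ?I + ?Q * ?J) / 2) {t0..tf}"
    using assms
    by (intro has_integral_divide has_integral_add has_integral_mult_right has_integral_exp_square)
      auto
  moreover have "(norm (sysmat lam gam *v (sysmat lam gam *v x t)))\<^sup>2
      = (?P * (exp (- lam * (t - tf)))\<^sup>2 + ?Q * (exp (- (lam + gam) * (t - tf)))\<^sup>2) / 2"
    if "t \<in> {t0..tf}" for t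
    unfolding norm_sysmat_sysmat feasible_sum_diff[OF assms(1) that] power_mult_distrib
    by (simp only: ac_simps)
  ultimately have "((\<lambda>t. (norm (sysmat lam gam *v (sysmat lam gam *v x t)))\<^sup>2)
      has_integral (?P * ?I + ?Q * ?J) / 2) {t0..tf}"
    by (simp only: cong: has_integral_cong)
  then show ?thesis
    unfolding objective_def by (rule integral_unique)
qed

text \<open>The all-ones vector \<open>1\<close> spans the slow eigenspace. Its components agree, so
  one formula meets the final condition for either value of \<open>j\<close>.\<close>

lemma feasible_slow:
  "feasible (sysmat lam gam) t0 tf j c (\<lambda>t. (c * exp (- lam * (t - tf))) *\<^sub>R 1)"
proof -
  have "sysmat lam gam *v (r *\<^sub>R 1) = (- lam * r) *\<^sub>R 1" for r
    by (simp add: vec_eq_iff forall_2 sysmat_nth algebra_simps)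
  moreover have "((\<lambda>t. (c * exp (- lam * (t - tf))) *\<^sub>R (1 :: real^2)) has_vector_derivative
      (- lam * (c * exp (- lam * (t - tf)))) *\<^sub>R 1) (at t within {t0..tf})" for t
    by (rule derivative_eq_intros refl | simp add: algebra_simps)+
  ultimately show ?thesis
    by (simp add: feasible_def)
qed

lemma optimal_fast_bound:
  assumes opt: "optimal (sysmat lam gam) t0 tf j c x" and "t0 < tf" "lam > 0" "gam > 0"
  shows "(x tf $ 1 - x tf $ 2)\<^sup>2 \<le> 4 * c\<^sup>2 * lam ^ 3 / (lam + gam) ^ 3 *
    ((exp (2 * lam * (tf - t0)) - 1) / (exp (2 * (lam + gam) * (tf - t0)) - 1))"
proof -
  define E F where "E = exp (2 * lam * (tf - t0)) - 1"
    and "F = exp (2 * (lam + gam) * (tf - t0)) - 1"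
  define U V where "U = x tf $ 1 + x tf $ 2" and "V = x tf $ 1 - x tf $ 2"
  define m where "m = lam + gam"
  have pos: "E > 0" "F > 0" "m > 0"
    using assms by (auto simp: E_def F_def m_def)
  note feas = feasible_slow[of lam gam t0 tf j c]
  have "feasible (sysmat lam gam) t0 tf j c x"
    and le: "objective (sysmat lam gam) t0 tf x
      \<le> objective (sysmat lam gam) t0 tf (\<lambda>t. (c * exp (- lam * (t - tf))) *\<^sub>R 1)"
    using opt feas by (auto simp: optimal_def)
  \<comment> \<open>The slow competitor ends with sum \<open>2 * c\<close> and difference 0, so its
    fast term vanishes.\<close>
  from le have "lam ^ 4 * U\<^sup>2 * (E / (2 * lam)) + m ^ 4 * V\<^sup>2 * (F / (2 * m))
      \<le> lam ^ 4 * (2 * c)\<^sup>2 * (E / (2 * lam))"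
    using assms objective_feasible[OF feas] objective_feasible[OF \<open>feasible _ _ _ _ _ x\<close>]
    by (simp add: E_def F_def U_def V_def m_def)
  \<comment> \<open>The slow cost of the optimal trajectory is simply discarded, which leaves a
    bound on its fast cost alone.\<close>
  moreover have "0 \<le> lam ^ 4 * U\<^sup>2 * (E / (2 * lam))"
    using pos assms by simp
  ultimately have "m ^ 4 * V\<^sup>2 * (F / (2 * m)) \<le> lam ^ 4 * (2 * c)\<^sup>2 * (E / (2 * lam))"
    by linarith
  \<comment> \<open>On each side one power of the rate cancels against the denominator of the
    integral, leaving cubes.\<close>
  then have "V\<^sup>2 * (m ^ 3 * F) \<le> 4 * c\<^sup>2 * lam ^ 3 * E"
    using pos assms by (simp add: power_mult_distrib eval_nat_numeral field_simps)
  then have "V\<^sup>2 \<le> 4 * c\<^sup>2 * lam ^ 3 * E / (m ^ 3 * F)"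
    using pos by (simp add: pos_le_divide_eq)
  then show ?thesis
    by (simp add: E_def F_def V_def m_def)
qed

lemma infdist_slow_eigenspace_le:
  "infdist x (eigenspace (sysmat lam gam) (- lam)) \<le> \<bar>x $ 1 - x $ 2\<bar>"
proof -
  \<comment> \<open>The orthogonal projection of \<open>x\<close> onto the diagonal. The residual
    has sum 0 and the same difference as \<open>x\<close>, so its norm is in fact smaller than the
    bound by a factor \<open>sqrt 2\<close>.\<close>
  define b :: "real^2" where "b = ((x $ 1 + x $ 2) / 2) *\<^sub>R 1"
  have "b \<in> eigenspace (sysmat lam gam) (- lam)"
    by (simp add: b_def eigenspace_def vec_eq_iff forall_2 sysmat_nth algebra_simps)
  then have "infdist x (eigenspace (sysmat lam gam) (- lam)) \<le> norm (x - b)"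
    by (metis dist_norm infdist_le)
  also have "(norm (x - b))\<^sup>2 \<le> \<bar>x $ 1 - x $ 2\<bar>\<^sup>2"
    by (simp add: norm_square_sum_diff b_def)
  then have "norm (x - b) \<le> \<bar>x $ 1 - x $ 2\<bar>"
    by (rule power2_le_imp_le) simp
  finally show ?thesis .
qed

theorem theorem3p1:
  fixes lam gam tf c :: real
    and j :: 2
    and xs :: "real \<Rightarrow> real \<Rightarrow> real^2"
  assumes "lam > 0" and "gam > 0"
    and "\<And>t0. t0 < tf \<Longrightarrow> optimal (sysmat lam gam) t0 tf j c (xs t0)"
  shows "((\<lambda>t0. infdist (xs t0 tf) (eigenspace (sysmat lam gam) (- lam))) \<longlongrightarrow> 0) at_bot"
proof -
  define g where "g t0 = sqrt (4 * c\<^sup>2 * lam ^ 3 / (lam + gam) ^ 3 *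
    ((exp (2 * lam * (tf - t0)) - 1) / (exp (2 * (lam + gam) * (tf - t0)) - 1)))" for t0
  have "((\<lambda>t0. (exp (2 * lam * (tf - t0)) - 1) / (exp (2 * (lam + gam) * (tf - t0)) - 1)) \<longlongrightarrow> 0) at_bot"
    using assms(1,2) by real_asymp
  \<comment> \<open>The prefactor in \<open>g\<close> does not depend on \<open>t0\<close>, so the
    limit of the ratio passes through the product and the square root.\<close>
  from tendsto_real_sqrt[OF tendsto_mult_left[OF this]]
  have g: "(g \<longlongrightarrow> 0) at_bot"
    unfolding g_def mult_zero_right real_sqrt_zero .
  \<comment> \<open>Optimality is given only for \<open>t0 < tf\<close>, so the comparison with
    \<open>g\<close> is an eventual one.\<close>
  have "eventually (\<lambda>t0. infdist (xs t0 tf) (eigenspace (sysmat lam gam) (- lam)) \<le> g t0) at_bot"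
    using eventually_gt_at_bot[of tf]
  proof eventually_elim
    case (elim t0)
    have "\<bar>xs t0 tf $ 1 - xs t0 tf $ 2\<bar> \<le> g t0"
      using optimal_fast_bound[OF assms(3)[OF elim] elim assms(1,2)]
      unfolding g_def by (metis real_sqrt_abs real_sqrt_le_mono)
    with infdist_slow_eigenspace_le show ?case
      by (rule order_trans)
  qed
  then show ?thesis
    by (intro tendsto_sandwich[OF _ _ tendsto_const g]) (auto simp: infdist_nonneg)
qed

end
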